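(* Soft value iteration, as described in the context, converges: for the policy $\pi^o_{x,\xi}$ it returns after $T$ iterations one has $\|\pi^*_{x,\xi}-\pi^o_{x,\xi}\|_\infty^2\le\delta^2$, where $T=\mathcal{O}(\log(1/\delta))$.
   Context: Setting. $\mathcal M_{x,\xi}=(\mathcal S,\mathcal A,r,P,\mu,\gamma)$ is a Markov decision process (depending on parameters $x,\xi$, suppressed in $r=r_{x,\xi}$, $P=P_{x,\xi}$, $\mu=\mu_{x,\xi}$) with finite state space $\mathcal S$, finite action space $\mathcal A$, reward bounded by $|r(s,a)|<\overline R$ uniformly in $x,\xi,s,a$, transition kernel $P(s';s,a)$, initial distribution $\mu$ and discount factor $\gamma\in(0,1)$. Fix $\lambda>0$. A policy $\pi$ assigns to each state $s$ a distribution $\pi(\cdot;s)$ on $\mathcal A$; $H(\pi;s)=-\sum_a\pi(a;s)\log\pi(a;s)$. $\pi^*_{x,\xi}$ is the optimal policy for the entropy-regularized objective $\mathbb{E}[\sum_{t\ge0}\gamma^t(r(s_t,a_t)+\lambda H(\pi;s_t))]$ ($s_0\sim\mu$, $a_t\sim\pi(\cdot;s_t)$, $s_{t+1}\sim P(\cdot;s_t,a_t)$), given by $\pi^*_{x,\xi}(a;s)\propto\exp(Q^*_\lambda(s,a)/\lambda)$ with $Q^*_\lambda$ the optimal regularized Q-function. $\|\pi_1-\pi_2\|_\infty=\max_{s,a}|\pi_1(a;s)-\pi_2(a;s)|$. Soft value iteration. Start with $V_\lambda=0$. In each iteration compute, for all $s,a$, $Q_\lambda(s,a)=r(s,a)+\gamma\,\mathbb{E}_{s'\sim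 P(\cdot;s,a)}[V_\lambda(s')]$ and then replace $V_\lambda(s)$ by $\lambda\log\bigl(\sum_{a}\exp(Q_\lambda(s,a)/\lambda)\bigr)$ for all $s$. After $T$ iterations return $\pi^o_{x,\xi}(a;s)=\exp(Q_\lambda(s,a)/\lambda)/\sum_{a'}\exp(Q_\lambda(s,a')/\lambda)$ computed from the last $Q_\lambda$. $\mathcal{O}(\log(1/\delta))$ is as $\delta\to0$, with constants independent of $\delta$. *)

theory Defs
  imports "HOL-Probability.Probability" "HOL-Library.Landau_Symbols"
begin

text \<open>States and actions are finite types \<^typ>\<open>'s\<close> and \<^typ>\<open>'a\<close>.
  A policy is a map \<^typ>\<open>'s \<Rightarrow> 'a pmf\<close>, so that \<open>pmf (\<pi> s) a\<close> is \<open>\<pi>(a; s)\<close>;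
  likewise \<open>pmf (P s a) s'\<close> is \<open>P(s'; s, a)\<close>.\<close>

definition state_action :: "('s \<Rightarrow> 'a pmf) \<Rightarrow> 's pmf \<Rightarrow> ('s \<times> 'a) pmf" where
  "state_action \<pi> \<nu> = bind_pmf \<nu> (\<lambda>s. map_pmf (Pair s) (\<pi> s))"

text \<open>Conditional law of \<open>(s\<^sub>t, a\<^sub>t)\<close> given the state-action pairs before time \<open>t\<close>.\<close>

definition step_kernel ::
    "('s \<Rightarrow> 'a \<Rightarrow> 's pmf) \<Rightarrow> 's pmf \<Rightarrow> ('s \<Rightarrow> 'a pmf) \<Rightarrow> nat \<Rightarrow> (nat \<Rightarrow> 's \<times> 'a) \<Rightarrow> ('s \<times> 'a) measure" where
  "step_kernel P \<mu> \<pi> t \<omega> =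
     measure_pmf (state_action \<pi> (case t of 0 \<Rightarrow> \<mu> | Suc u \<Rightarrow> P (fst (\<omega> u)) (snd (\<omega> u))))"

lemma Ionescu_Tulcea_step_kernel:
  fixes P :: "'s::finite \<Rightarrow> 'a::finite \<Rightarrow> 's pmf"
  shows "Ionescu_Tulcea (step_kernel P \<mu> \<pi>) (\<lambda>_. count_space UNIV)"
proof (rule Ionescu_Tulcea.intro)
  fix i :: nat
  show "step_kernel P \<mu> \<pi> i
      \<in> measurable (PiM {0..<i} (\<lambda>_. count_space UNIV)) (subprob_algebra (count_space UNIV))"
  proof (cases i)
    case 0
    then show ?thesis
      by (simp add: step_kernel_def [abs_def] measure_pmf_in_subprob_algebra)
  next
    case (Suc u)
    let ?K = "\<lambda>z. measure_pmf (state_action \<pi> (P (fst z) (snd z)))"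
    have "(\<lambda>\<omega>. \<omega> u) \<in> measurable (PiM {0..<i} (\<lambda>_. count_space (UNIV :: ('s \<times> 'a) set))) (count_space UNIV)"
      by (rule measurable_component_singleton) (simp add: Suc)
    moreover have "?K \<in> measurable (count_space UNIV) (subprob_algebra (count_space UNIV))"
      by (simp add: measure_pmf_in_subprob_algebra)
    ultimately have "(\<lambda>\<omega>. ?K (\<omega> u))
        \<in> measurable (PiM {0..<i} (\<lambda>_. count_space UNIV)) (subprob_algebra (count_space UNIV))"
      by (rule measurable_compose)
    then show ?thesis
      by (simp add: step_kernel_def [abs_def] Suc)
  qed
next
  show "prob_space (step_kernel P \<mu> \<pi> i \<omega>)" for i \<omega>
    by (simp add: step_kernel_def measure_pmf.prob_space_axioms)
qed

text \<open>The Ionescu-Tulcea law on infinite trajectories: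
  \<open>s\<^sub>0 \<sim> \<mu>\<close>, \<open>a\<^sub>t \<sim> \<pi>(\<cdot>; s\<^sub>t)\<close>, \<open>s\<^sub>t\<^sub>+\<^sub>1 \<sim> P(\<cdot>; s\<^sub>t, a\<^sub>t)\<close>.\<close>

definition trajectory ::
    "('s::finite \<Rightarrow> 'a::finite \<Rightarrow> 's pmf) \<Rightarrow> 's pmf \<Rightarrow> ('s \<Rightarrow> 'a pmf) \<Rightarrow> (nat \<Rightarrow> 's \<times> 'a) measure" where
  "trajectory P \<mu> \<pi> =
     projective_family.lim UNIV
       (Ionescu_Tulcea.CI (step_kernel P \<mu> \<pi>) (\<lambda>_. count_space UNIV)) (\<lambda>_. count_space UNIV)"

text \<open>The regularization weight is written \<open>\<tau>\<close>. Since \<^term>\<open>ln (0::real) = 0\<close>, actions of probability zero contribute zero.\<close>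

definition entropy_at :: "('s \<Rightarrow> 'a::finite pmf) \<Rightarrow> 's \<Rightarrow> real" where
  "entropy_at \<pi> s = - (\<Sum>a\<in>UNIV. pmf (\<pi> s) a * ln (pmf (\<pi> s) a))"

definition objective ::
    "('s::finite \<Rightarrow> 'a::finite \<Rightarrow> real) \<Rightarrow> ('s \<Rightarrow> 'a \<Rightarrow> 's pmf) \<Rightarrow> real \<Rightarrow> real \<Rightarrow> 's pmf \<Rightarrow> ('s \<Rightarrow> 'a pmf) \<Rightarrow> real" where
  "objective r P \<gamma> \<tau> \<mu> \<pi> =
     (\<integral>\<omega>. (\<Sum>t. \<gamma> ^ t * (case \<omega> t of (s, a) \<Rightarrow> r s a + \<tau> * entropy_at \<pi> s)) \<partial>trajectory P \<mu> \<pi>)"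

definition state_value ::
    "('s::finite \<Rightarrow> 'a::finite \<Rightarrow> real) \<Rightarrow> ('s \<Rightarrow> 'a \<Rightarrow> 's pmf) \<Rightarrow> real \<Rightarrow> real \<Rightarrow> ('s \<Rightarrow> 'a pmf) \<Rightarrow> 's \<Rightarrow> real" where
  "state_value r P \<gamma> \<tau> \<pi> s = objective r P \<gamma> \<tau> (return_pmf s) \<pi>"

definition q_backup ::
    "('s \<Rightarrow> 'a \<Rightarrow> real) \<Rightarrow> ('s \<Rightarrow> 'a \<Rightarrow> 's pmf) \<Rightarrow> real \<Rightarrow> ('s \<Rightarrow> real) \<Rightarrow> 's \<Rightarrow> 'a \<Rightarrow> real" where
  "q_backup r P \<gamma> V s a = r s a + \<gamma> * measure_pmf.expectation (P s a) V"

text \<open>The regularized Q-function of a policy carries no entropy bonus for the initial state,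
  whose action is prescribed.\<close>

definition q_value ::
    "('s::finite \<Rightarrow> 'a::finite \<Rightarrow> real) \<Rightarrow> ('s \<Rightarrow> 'a \<Rightarrow> 's pmf) \<Rightarrow> real \<Rightarrow> real \<Rightarrow> ('s \<Rightarrow> 'a pmf) \<Rightarrow> 's \<Rightarrow> 'a \<Rightarrow> real" where
  "q_value r P \<gamma> \<tau> \<pi> = q_backup r P \<gamma> (state_value r P \<gamma> \<tau> \<pi>)"

definition opt_q ::
    "('s::finite \<Rightarrow> 'a::finite \<Rightarrow> real) \<Rightarrow> ('s \<Rightarrow> 'a \<Rightarrow> 's pmf) \<Rightarrow> real \<Rightarrow> real \<Rightarrow> 's \<Rightarrow> 'a \<Rightarrow> real" where
  "opt_q r P \<gamma> \<tau> s a = (SUP \<pi>. q_value r P \<gamma> \<tau> \<pi> s a)"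

definition softmax :: "real \<Rightarrow> ('a::finite \<Rightarrow> real) \<Rightarrow> 'a pmf" where
  "softmax \<tau> q = embed_pmf (\<lambda>a. exp (q a / \<tau>) / (\<Sum>a'\<in>UNIV. exp (q a' / \<tau>)))"

lemma pmf_softmax: "pmf (softmax \<tau> q) a = exp (q a / \<tau>) / (\<Sum>a'\<in>UNIV. exp (q a' / \<tau>))"
  unfolding softmax_def
proof (rule pmf_embed_pmf)
  show "0 \<le> exp (q a / \<tau>) / (\<Sum>a'\<in>UNIV. exp (q a' / \<tau>))" for a
    by (simp add: sum_nonneg)
  have pos: "0 < (\<Sum>a'\<in>UNIV. exp (q a' / \<tau>))"
    by (rule sum_pos) auto
  have "(\<integral>\<^sup>+a. ennreal (exp (q a / \<tau>) / (\<Sum>a'\<in>UNIV. exp (q a' / \<tau>))) \<partial>count_space UNIV)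
      = ennreal (\<Sum>a\<in>UNIV. exp (q a / \<tau>) / (\<Sum>a'\<in>UNIV. exp (q a' / \<tau>)))"
    using pos by (simp add: nn_integral_count_space_finite sum_ennreal less_imp_le)
  also have "(\<Sum>a\<in>UNIV. exp (q a / \<tau>) / (\<Sum>a'\<in>UNIV. exp (q a' / \<tau>))) = 1"
    using pos by (simp add: sum_divide_distrib [symmetric])
  finally show "(\<integral>\<^sup>+a. ennreal (exp (q a / \<tau>) / (\<Sum>a'\<in>UNIV. exp (q a' / \<tau>))) \<partial>count_space UNIV) = 1"
    by simp
qed

text \<open>Maximality of the objective leaves the policy undetermined at states that are not reached
  from \<open>\<mu>\<close>; the second conjunct singles out one maximizer.\<close>

definition optimal_policy ::
    "('s::finite \<Rightarrow> 'a::finite \<Rightarrow> real) \<Rightarrow> ('s \<Rightarrow> 'a \<Rightarrow> 's pmf) \<Rightarrow> real \<Rightarrow> real \<Rightarrow> 's pmf \<Rightarrow> ('s \<Rightarrow> 'a pmf) \<Rightarrow> bool" where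
  "optimal_policy r P \<gamma> \<tau> \<mu> \<pi> \<longleftrightarrow>
     (\<forall>\<pi>'. objective r P \<gamma> \<tau> \<mu> \<pi>' \<le> objective r P \<gamma> \<tau> \<mu> \<pi>) \<and>
     (\<forall>s. \<pi> s = softmax \<tau> (opt_q r P \<gamma> \<tau> s))"

fun svi_value ::
    "('s \<Rightarrow> 'a::finite \<Rightarrow> real) \<Rightarrow> ('s \<Rightarrow> 'a \<Rightarrow> 's pmf) \<Rightarrow> real \<Rightarrow> real \<Rightarrow> nat \<Rightarrow> 's \<Rightarrow> real" where
  "svi_value r P \<gamma> \<tau> 0 = (\<lambda>s. 0)"
| "svi_value r P \<gamma> \<tau> (Suc n) =
     (\<lambda>s. \<tau> * ln (\<Sum>a\<in>UNIV. exp (q_backup r P \<gamma> (svi_value r P \<gamma> \<tau> n) s a / \<tau>)))"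

text \<open>The \<open>T\<close>-th iteration computes its Q-function from the value function left by the first
  \<open>T - 1\<close> iterations. No Q-function is computed when \<open>T = 0\<close>, so this is meaningful only for
  \<open>T \<ge> 1\<close>.\<close>

definition svi_policy ::
    "('s \<Rightarrow> 'a::finite \<Rightarrow> real) \<Rightarrow> ('s \<Rightarrow> 'a \<Rightarrow> 's pmf) \<Rightarrow> real \<Rightarrow> real \<Rightarrow> nat \<Rightarrow> 's \<Rightarrow> 'a pmf" where
  "svi_policy r P \<gamma> \<tau> T s = softmax \<tau> (q_backup r P \<gamma> (svi_value r P \<gamma> \<tau> (T - 1)) s)"

definition policy_dist :: "('s::finite \<Rightarrow> 'a::finite pmf) \<Rightarrow> ('s \<Rightarrow> 'a pmf) \<Rightarrow> real" where
  "policy_dist \<pi>\<^sub>1 \<pi>\<^sub>2 = (MAX (s, a)\<in>UNIV. \<bar>pmf (\<pi>\<^sub>1 s) a - pmf (\<pi>\<^sub>2 s) a\<bar>)"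

end

theory Submission
  imports Defs
begin

text \<open>
  The soft Bellman operator, which sends a value function \<open>V\<close> to
  \<open>s \<mapsto> \<tau> log (\<Sum>a. exp (Q(s, a) / \<tau>))\<close> with \<open>Q\<close> the one-step backup of \<open>V\<close>, is a
  \<open>\<gamma>\<close>-contraction in the supremum norm: averaging over successor states and log-sum-exp are both
  nonexpansive, and only the discount remains. Starting from \<open>0\<close>, soft value iteration stays bounded
  by \<open>C = (R + \<tau> log |A|) / (1 - \<gamma>)\<close> and hence converges to a fixed point \<open>V\<close>, with error at most
  \<open>C \<gamma>\<^sup>n\<close> after \<open>n\<close> steps (\<open>svi_value_geometric_convergence\<close>). Softmax is
  \<open>2/\<tau>\<close>-Lipschitz, so the returned policy is within \<open>2 C \<gamma>\<^sup>n / \<tau>\<close> of the softmax of the backup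
  of \<open>V\<close>, and making this smaller than \<open>\<delta>\<close> takes a number of iterations that is logarithmic in
  \<open>1/\<delta>\<close>. The bound sees the model only through \<open>R\<close>, \<open>\<gamma>\<close>, \<open>\<tau>\<close> and the number of actions, so
  it is uniform in the parameters.

  It remains to identify the backup of \<open>V\<close> with the optimal regularized Q-function, which is defined
  as a supremum, over stationary policies, of expectations over infinite trajectories
  (\<open>opt_q_eq_q_backup\<close>). Evaluating a policy \<open>\<pi>\<close> against an arbitrary
  function \<open>V\<close>, the discounted rewards telescope: the objective is the mean of \<open>V\<close> at the start plus
  the discounted sum of the expected one-step defects of \<open>V\<close> under \<open>\<pi>\<close>
  (\<open>objective_eq_defect_sum\<close>). When \<open>V\<close> solves the soft Bellman equation, Gibbs' variational
  inequality says that these defects are nonpositive for every \<open>\<pi>\<close> and vanish for the softmax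
  policy of \<open>V\<close>. So \<open>V\<close> dominates the value of every policy, and the softmax policy attains it.
\<close>

section \<open>Discounted sums along a trajectory\<close>

text \<open>The law of the state at time \<open>t\<close>, computed by the Chapman-Kolmogorov recursion instead of as
  a marginal of the trajectory measure.\<close>

primrec visit_law ::
    "('s \<Rightarrow> 'a \<Rightarrow> 's pmf) \<Rightarrow> 's pmf \<Rightarrow> ('s \<Rightarrow> 'a pmf) \<Rightarrow> nat \<Rightarrow> 's pmf" where
  "visit_law P \<mu> \<pi> 0 = \<mu>"
| "visit_law P \<mu> \<pi> (Suc t) =
     bind_pmf (state_action \<pi> (visit_law P \<mu> \<pi> t)) (\<lambda>z. P (fst z) (snd z))"

lemma state_action_bind:
  "state_action \<pi> (bind_pmf \<nu> f) = bind_pmf \<nu> (\<lambda>z. state_action \<pi> (f z))"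
  by (simp add: state_action_def bind_assoc_pmf)

text \<open>All coordinates are integrated out except the last one. The projective limit restricts to the
  Ionescu-Tulcea law \<open>C\<close> of the first \<open>t + 1\<close> pairs, whose last coordinate is drawn from the step
  kernel; that kernel reads only the preceding pair, so the marginals satisfy the recursion of
  \<open>visit_law\<close>.\<close>

lemma distr_trajectory:
  fixes P :: "'s::finite \<Rightarrow> 'a::finite \<Rightarrow> 's pmf"
  shows "distr (trajectory P \<mu> \<pi>) (count_space UNIV) (\<lambda>\<omega>. \<omega> t) =
    measure_pmf (state_action \<pi> (visit_law P \<mu> \<pi> t))"
proof -
  let ?M = "\<lambda>_::nat. count_space (UNIV :: ('s \<times> 'a) set)"
  let ?K = "step_kernel P \<mu> \<pi>"
  interpret IT: Ionescu_Tulcea ?K ?M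
    by (rule Ionescu_Tulcea_step_kernel)
  let ?u = "\<lambda>_::nat. undefined :: 's \<times> 'a"
  let ?C = "\<lambda>n. IT.C 0 n ?u"
  have u: "?u \<in> space (PiM {0..<0} ?M)"
    by (simp add: space_PiM)
  have C_sets: "sets (?C n) = sets (PiM {0..<n} ?M)" for n
    using IT.sets_C[OF u] by simp
  have C_space: "space (?C n) = space (PiM {0..<n} ?M)" for n
    by (rule sets_eq_imp_space_eq[OF C_sets])
  have C_nonempty: "space (?C n) \<noteq> {}" for n
    using IT.prob_space_C[OF u, THEN prob_space.not_empty] by simp
  have coord: "(\<lambda>\<omega>. \<omega> k) \<in> measurable (PiM {0..<n} ?M) (count_space UNIV)" if "k < n" for k n
    using measurable_component_singleton[of k "{0..<n}" ?M] that by simp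
  have last_coord: "distr (?C (Suc n)) (count_space UNIV) (\<lambda>\<omega>. \<omega> n) = bind (?C n) (?K n)" for n
  proof -
    have "distr (IT.eP n \<omega>) (count_space UNIV) (\<lambda>\<omega>. \<omega> n) = ?K n \<omega>"
      if \<omega>: "\<omega> \<in> space (PiM {0..<n} ?M)" for \<omega>
    proof -
      have "fun_upd \<omega> n \<in> measurable (?K n \<omega>) (PiM {0..<Suc n} ?M)"
        using \<omega> by (intro measurable_fun_upd[where J="{0..<n}"])
          (auto simp: IT.sets_P[OF \<omega>] cong: measurable_cong_sets)
      then have "distr (IT.eP n \<omega>) (count_space UNIV) (\<lambda>\<omega>. \<omega> n) =
          distr (?K n \<omega>) (count_space UNIV) (\<lambda>x. x)"
        by (simp add: IT.eP_def distr_distr[OF coord] comp_def)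
      then show ?thesis
        by (simp add: distr_id2 IT.sets_P[OF \<omega>])
    qed
    moreover have "IT.eP n \<in> measurable (?C n) (subprob_algebra (PiM {0..<Suc n} ?M))"
      using IT.measurable_eP measurable_cong_sets[OF C_sets refl] by blast
    ultimately show ?thesis
      unfolding IT.C.simps
      by (subst distr_bind[OF _ C_nonempty coord]) (auto intro!: bind_cong simp: C_space)
  qed
  have marginal: "distr (?C (Suc n)) (count_space UNIV) (\<lambda>\<omega>. \<omega> n) =
      measure_pmf (state_action \<pi> (visit_law P \<mu> \<pi> n))" for n
  proof (induction n)
    case 0
    have "bind (?C 0) (?K 0) = ?K 0 ?u"
      unfolding IT.C.simps by (rule bind_return[OF IT.P u])
    then show ?case
      unfolding last_coord by (simp add: step_kernel_def)
  next
    case (Suc n)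
    let ?N = "\<lambda>z. measure_pmf (state_action \<pi> (P (fst z) (snd z)))"
    have c: "(\<lambda>\<omega>. \<omega> n) \<in> measurable (?C (Suc n)) (count_space UNIV)"
      using coord[of n "Suc n"] measurable_cong_sets[OF C_sets refl] by blast
    have "distr (?C (Suc (Suc n))) (count_space UNIV) (\<lambda>\<omega>. \<omega> (Suc n)) =
        bind (?C (Suc n)) (\<lambda>\<omega>. ?N (\<omega> n))"
      unfolding last_coord by (simp add: step_kernel_def [abs_def] del: IT.C.simps)
    also have "\<dots> = bind (distr (?C (Suc n)) (count_space UNIV) (\<lambda>\<omega>. \<omega> n)) ?N"
      by (rule bind_distr[where K = "count_space UNIV", symmetric, OF c _ C_nonempty])
        (simp add: measure_pmf_in_subprob_algebra)
    also have "\<dots> = measure_pmf (state_action \<pi> (visit_law P \<mu> \<pi> (Suc n)))"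
      unfolding Suc.IH by (simp add: state_action_bind measure_pmf_bind)
    finally show ?case .
  qed
  let ?J = "{0..<Suc t}"
  have "distr (trajectory P \<mu> \<pi>) (count_space UNIV) (\<lambda>\<omega>. \<omega> t) =
      distr (distr IT.PF.lim (PiM ?J ?M) (\<lambda>\<omega>. restrict \<omega> ?J)) (count_space UNIV) (\<lambda>\<omega>. \<omega> t)"
    unfolding trajectory_def
    by (subst distr_distr[OF coord])
      (auto simp: comp_def measurable_cong_sets[OF IT.PF.sets_lim refl] intro!: measurable_restrict_subset)
  also have "\<dots> = distr (IT.CI ?J) (count_space UNIV) (\<lambda>\<omega>. \<omega> t)"
    by (subst IT.distr_lim) simp_all
  also have "IT.CI ?J = ?C (Suc t)"
  proof -
    have "IT.up_to ?J = Suc t"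
      by (intro antisym) (auto simp: IT.up_to_iff_Ico Suc_le_eq intro!: IT.up_to_less)
    then show ?thesis
      using IT.distr_C[OF _ u, of "Suc t" "Suc t"] by (simp add: IT.CI_def del: IT.C.simps)
  qed
  finally show ?thesis
    using marginal by simp
qed

lemma integrable_measure_pmf_finite_type:
  "integrable (measure_pmf (p :: 'b::finite pmf)) (f :: 'b \<Rightarrow> real)"
  by (rule integrable_measure_pmf_finite) simp

lemma expectation_mono_finite_type:
  fixes f g :: "'b::finite \<Rightarrow> real"
  assumes "\<And>x. f x \<le> g x"
  shows "measure_pmf.expectation p f \<le> measure_pmf.expectation p g"
  by (intro integral_mono integrable_measure_pmf_finite_type assms)

lemma abs_expectation_le:
  fixes f :: "'b::finite \<Rightarrow> real"
  assumes "\<And>x. \<bar>f x\<bar> \<le> c"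
  shows "\<bar>measure_pmf.expectation p f\<bar> \<le> c"
proof -
  have "f x \<le> c" "- c \<le> f x" for x
    using assms[of x] by auto
  then show ?thesis
    using expectation_mono_finite_type[of f "\<lambda>_. c" p]
      expectation_mono_finite_type[of "\<lambda>_. - c" f p] by auto
qed

lemma expectation_bind_finite_type:
  fixes h :: "'c::finite \<Rightarrow> real" and p :: "'b::finite pmf"
  shows "measure_pmf.expectation (bind_pmf p f) h =
    measure_pmf.expectation p (\<lambda>x. measure_pmf.expectation (f x) h)"
  by (subst pmf_expectation_bind[of UNIV])
    (auto simp: integral_measure_pmf_real[of UNIV] mult.commute)

lemma expectation_state_action:
  fixes f :: "'s::finite \<times> 'a::finite \<Rightarrow> real"
  shows "measure_pmf.expectation (state_action \<pi> \<nu>) f =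
    measure_pmf.expectation \<nu> (\<lambda>s. \<Sum>a\<in>UNIV. pmf (\<pi> s) a * f (s, a))"
  by (simp add: state_action_def expectation_bind_finite_type integral_measure_pmf_real[of UNIV]
      mult.commute)

text \<open>Integral and series may be exchanged because \<open>f\<close>, living on a finite type, is bounded, so that
  the terms are dominated by a geometric series. After the exchange only the marginals matter.\<close>

lemma integral_discounted_trajectory:
  fixes P :: "'s::finite \<Rightarrow> 'a::finite \<Rightarrow> 's pmf" and f :: "'s \<times> 'a \<Rightarrow> real"
  assumes \<gamma>: "0 \<le> \<gamma>" "\<gamma> < 1"
  shows "(\<integral>\<omega>. (\<Sum>t. \<gamma> ^ t * f (\<omega> t)) \<partial>trajectory P \<mu> \<pi>) =
    (\<Sum>t. \<gamma> ^ t * measure_pmf.expectation (state_action \<pi> (visit_law P \<mu> \<pi> t)) f)"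
proof -
  let ?M = "trajectory P \<mu> \<pi>"
  interpret IT: Ionescu_Tulcea "step_kernel P \<mu> \<pi>" "\<lambda>_. count_space UNIV"
    by (rule Ionescu_Tulcea_step_kernel)
  have coord [measurable]: "(\<lambda>\<omega>. \<omega> t) \<in> measurable ?M (count_space UNIV)" for t
    unfolding trajectory_def measurable_cong_sets[OF IT.PF.sets_lim refl] by simp
  interpret prob_space ?M
    by (rule prob_space_distrD[OF coord[of 0]])
      (simp add: distr_trajectory measure_pmf.prob_space_axioms)
  define c where "c = Max (range (\<lambda>z. \<bar>f z\<bar>))"
  have c: "\<bar>f z\<bar> \<le> c" for z
    unfolding c_def by (rule Max_ge) auto
  have meas [measurable]: "(\<lambda>\<omega>. f (\<omega> t)) \<in> borel_measurable ?M" for t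
    by (rule measurable_compose[OF coord]) simp
  have term_bound: "\<bar>\<gamma> ^ t * f z\<bar> \<le> \<gamma> ^ t * c" for t z
    using \<gamma> c[of z] by (simp add: abs_mult mult_left_mono)
  have geometric: "summable (\<lambda>t. \<gamma> ^ t * c)"
    using \<gamma> by (intro summable_mult2 summable_geometric) auto
  have integrable: "integrable ?M (\<lambda>\<omega>. \<gamma> ^ t * f (\<omega> t))" for t
    by (rule integrable_const_bound[where B = "\<gamma> ^ t * c"]) (use term_bound in auto)
  have "(\<integral>\<omega>. (\<Sum>t. \<gamma> ^ t * f (\<omega> t)) \<partial>?M) = (\<Sum>t. \<integral>\<omega>. \<gamma> ^ t * f (\<omega> t) \<partial>?M)"
  proof (rule integral_suminf[OF integrable])
    show "AE \<omega> in ?M. summable (\<lambda>t. norm (\<gamma> ^ t * f (\<omega> t)))"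
      using term_bound by (intro AE_I2 summable_comparison_test'[OF geometric]) auto
    have "(\<integral>\<omega>. norm (\<gamma> ^ t * f (\<omega> t)) \<partial>?M) \<le> (\<integral>\<omega>. \<gamma> ^ t * c \<partial>?M)" for t
      using term_bound integrable[of t] by (intro integral_mono integrable_norm) auto
    then show "summable (\<lambda>t. \<integral>\<omega>. norm (\<gamma> ^ t * f (\<omega> t)) \<partial>?M)"
      by (intro summable_comparison_test'[OF geometric]) (auto simp: prob_space)
  qed
  also have "(\<lambda>t. \<integral>\<omega>. \<gamma> ^ t * f (\<omega> t) \<partial>?M) =
      (\<lambda>t. \<gamma> ^ t * measure_pmf.expectation (state_action \<pi> (visit_law P \<mu> \<pi> t)) f)"
    by (simp add: distr_trajectory[symmetric] integral_distr[OF coord])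
  finally show ?thesis .
qed

section \<open>Policy evaluation against an arbitrary value function\<close>

text \<open>How far \<open>V\<close> is from the value of playing one step of \<open>\<pi>\<close> and collecting \<open>V\<close> afterwards.\<close>

definition bellman_defect ::
    "('s \<Rightarrow> 'a::finite \<Rightarrow> real) \<Rightarrow> ('s \<Rightarrow> 'a \<Rightarrow> 's pmf) \<Rightarrow> real \<Rightarrow> real \<Rightarrow> ('s \<Rightarrow> 'a pmf)
      \<Rightarrow> ('s \<Rightarrow> real) \<Rightarrow> 's \<Rightarrow> real" where
  "bellman_defect r P \<gamma> \<tau> \<pi> V s =
     (\<Sum>a\<in>UNIV. pmf (\<pi> s) a * q_backup r P \<gamma> V s a) + \<tau> * entropy_at \<pi> s - V s"

text \<open>This is the performance difference identity in regularized form. The expected reward of step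
  \<open>t\<close> is the expected defect plus the mean of \<open>V\<close> at time \<open>t\<close> minus \<open>\<gamma>\<close> times its mean at time
  \<open>t + 1\<close>; weighted by \<open>\<gamma> ^ t\<close>, the last two terms telescope. The summability statement allows the
  series to be compared termwise.\<close>

lemma objective_eq_defect_sum:
  fixes P :: "'s::finite \<Rightarrow> 'a::finite \<Rightarrow> 's pmf"
  assumes \<gamma>: "0 \<le> \<gamma>" "\<gamma> < 1"
  shows "objective r P \<gamma> \<tau> \<mu> \<pi> = measure_pmf.expectation \<mu> V +
      (\<Sum>t. \<gamma> ^ t * measure_pmf.expectation (visit_law P \<mu> \<pi> t) (bellman_defect r P \<gamma> \<tau> \<pi> V))"
    and "summable (\<lambda>t. \<gamma> ^ t *
      measure_pmf.expectation (visit_law P \<mu> \<pi> t) (bellman_defect r P \<gamma> \<tau> \<pi> V))"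
proof -
  let ?\<sigma> = "visit_law P \<mu> \<pi>"
  let ?E = "measure_pmf.expectation"
  let ?D = "bellman_defect r P \<gamma> \<tau> \<pi> V"
  define g where "g z = (case z of (s, a) \<Rightarrow> r s a + \<tau> * entropy_at \<pi> s)" for z
  have geometric_summable: "summable (\<lambda>t. \<gamma> ^ t * ?E (p t) f)" for p :: "nat \<Rightarrow> 's pmf" and f
  proof -
    define c where "c = Max (range (\<lambda>z. \<bar>f z\<bar>))"
    have c: "\<bar>f z\<bar> \<le> c" for z
      unfolding c_def by (rule Max_ge) auto
    have "summable (\<lambda>t. \<gamma> ^ t * c)"
      using \<gamma> by (intro summable_mult2 summable_geometric) auto
    then show ?thesis
      by (rule summable_comparison_test')
        (use \<gamma> abs_expectation_le[OF c] in \<open>auto simp: abs_mult intro!: mult_left_mono\<close>)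
  qed
  show summable_defect: "summable (\<lambda>t. \<gamma> ^ t * ?E (?\<sigma> t) ?D)"
    by (rule geometric_summable)
  have one_step: "?E (state_action \<pi> (?\<sigma> t)) g =
      ?E (?\<sigma> t) ?D + ?E (?\<sigma> t) V - \<gamma> * ?E (?\<sigma> (Suc t)) V" for t
  proof -
    have "?D s + V s = (\<Sum>a\<in>UNIV. pmf (\<pi> s) a * (g (s, a) + \<gamma> * ?E (P s a) V))" for s
    proof -
      have "(\<Sum>a\<in>UNIV. pmf (\<pi> s) a * (\<tau> * entropy_at \<pi> s)) = \<tau> * entropy_at \<pi> s"
        by (simp add: sum_distrib_right[symmetric] sum_pmf_eq_1)
      then show ?thesis
        by (simp add: bellman_defect_def g_def q_backup_def algebra_simps sum.distrib)
    qed
    then have "?E (?\<sigma> t) (\<lambda>s. ?D s + V s) =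
        ?E (state_action \<pi> (?\<sigma> t)) (\<lambda>z. g z + \<gamma> * ?E (P (fst z) (snd z)) V)"
      by (simp add: expectation_state_action)
    then show ?thesis
      by (simp add: expectation_bind_finite_type integrable_measure_pmf_finite_type)
  qed
  define b where "b t = \<gamma> ^ t * ?E (?\<sigma> t) V" for t
  have "b \<longlonglongrightarrow> 0"
    unfolding b_def by (rule summable_LIMSEQ_zero[OF geometric_summable])
  then have "(\<lambda>t. b t - b (Suc t)) sums b 0"
    using telescope_sums'[of b 0] by simp
  from sums_add[OF summable_sums[OF summable_defect] this]
  have "(\<lambda>t. \<gamma> ^ t * ?E (state_action \<pi> (?\<sigma> t)) g) sums
      ((\<Sum>t. \<gamma> ^ t * ?E (?\<sigma> t) ?D) + ?E \<mu> V)"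
    unfolding one_step by (simp add: b_def algebra_simps)
  then show "objective r P \<gamma> \<tau> \<mu> \<pi> = ?E \<mu> V + (\<Sum>t. \<gamma> ^ t * ?E (?\<sigma> t) ?D)"
    using integral_discounted_trajectory[OF \<gamma>, where f = g, of P \<mu> \<pi>]
    by (simp add: objective_def g_def[symmetric] sums_iff)
qed

section \<open>Log-sum-exp and softmax\<close>

definition log_sum_exp :: "real \<Rightarrow> ('a::finite \<Rightarrow> real) \<Rightarrow> real" where
  "log_sum_exp \<tau> q = \<tau> * ln (\<Sum>a\<in>UNIV. exp (q a / \<tau>))"

lemma sum_exp_pos: "0 < (\<Sum>a\<in>UNIV. exp (q a / \<tau> :: real))" for q :: "'a::finite \<Rightarrow> real"
  by (rule sum_pos) auto

lemma ln_pmf_softmax: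
  assumes "0 < \<tau>"
  shows "\<tau> * ln (pmf (softmax \<tau> q) a) = q a - log_sum_exp \<tau> q"
  using assms sum_exp_pos[of q \<tau>]
  by (simp add: pmf_softmax log_sum_exp_def ln_div right_diff_distrib)

text \<open>Writing \<open>w\<close> for the softmax weights, \<open>q = \<tau> ln w + log_sum_exp\<close>, so the claim is that
  the relative entropy of \<open>p\<close> with respect to \<open>w\<close> is nonnegative. This follows termwise from
  \<open>ln x \<le> x - 1\<close> at \<open>x = w / p\<close>.\<close>

lemma gibbs_inequality:
  fixes q :: "'a::finite \<Rightarrow> real"
  assumes \<tau>: "0 < \<tau>"
  shows "(\<Sum>a\<in>UNIV. pmf p a * q a) - \<tau> * (\<Sum>a\<in>UNIV. pmf p a * ln (pmf p a)) \<le> log_sum_exp \<tau> q"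
proof -
  let ?w = "pmf (softmax \<tau> q)"
  have pos: "0 < ?w a" for a
    using sum_exp_pos[of q \<tau>] by (simp add: pmf_softmax)
  have "pmf p a * (ln (?w a) - ln (pmf p a)) \<le> ?w a - pmf p a" for a
  proof (cases "pmf p a = 0")
    case False
    then have p: "0 < pmf p a"
      by (simp add: pmf_pos)
    have "ln (?w a / pmf p a) \<le> ?w a / pmf p a - 1"
      using p pos by (intro ln_le_minus_one) simp
    then have "pmf p a * ln (?w a / pmf p a) \<le> pmf p a * (?w a / pmf p a - 1)"
      using p by (intro mult_left_mono) auto
    then show ?thesis
      using p pos[of a] by (simp add: ln_div right_diff_distrib)
  qed simp
  then have "(\<Sum>a\<in>UNIV. pmf p a * (ln (?w a) - ln (pmf p a))) \<le> (\<Sum>a\<in>UNIV. ?w a - pmf p a)"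
    by (rule sum_mono)
  also have "\<dots> = 0"
    by (simp add: sum_subtractf sum_pmf_eq_1)
  finally have "\<tau> * (\<Sum>a\<in>UNIV. pmf p a * (ln (?w a) - ln (pmf p a))) \<le> 0"
    using \<tau> by (simp add: mult_nonneg_nonpos)
  also have "\<tau> * (\<Sum>a\<in>UNIV. pmf p a * (ln (?w a) - ln (pmf p a))) =
      (\<Sum>a\<in>UNIV. pmf p a * (\<tau> * ln (?w a))) - \<tau> * (\<Sum>a\<in>UNIV. pmf p a * ln (pmf p a))"
    by (simp add: sum_distrib_left sum_subtractf algebra_simps)
  also have "(\<Sum>a\<in>UNIV. pmf p a * (\<tau> * ln (?w a))) = (\<Sum>a\<in>UNIV. pmf p a * q a) - log_sum_exp \<tau> q"
    by (simp add: ln_pmf_softmax[OF \<tau>] right_diff_distrib sum_subtractf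
        sum_distrib_right[symmetric] sum_pmf_eq_1)
  finally show ?thesis
    by simp
qed

lemma gibbs_equality:
  fixes q :: "'a::finite \<Rightarrow> real"
  assumes \<tau>: "0 < \<tau>"
  shows "(\<Sum>a\<in>UNIV. pmf (softmax \<tau> q) a * q a)
    - \<tau> * (\<Sum>a\<in>UNIV. pmf (softmax \<tau> q) a * ln (pmf (softmax \<tau> q) a)) = log_sum_exp \<tau> q"
proof -
  let ?w = "pmf (softmax \<tau> q)"
  have "\<tau> * (\<Sum>a\<in>UNIV. ?w a * ln (?w a)) = (\<Sum>a\<in>UNIV. ?w a * (\<tau> * ln (?w a)))"
    by (simp add: sum_distrib_left algebra_simps)
  then show ?thesis
    by (simp add: ln_pmf_softmax[OF \<tau>] right_diff_distrib sum_subtractf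
        sum_distrib_right[symmetric] sum_pmf_eq_1)
qed

lemma sum_exp_shift_le:
  fixes q q' :: "'a::finite \<Rightarrow> real"
  assumes "0 < \<tau>" "\<And>a. q a \<le> q' a + \<epsilon>"
  shows "(\<Sum>a\<in>UNIV. exp (q a / \<tau>)) \<le> exp (\<epsilon> / \<tau>) * (\<Sum>a\<in>UNIV. exp (q' a / \<tau>))"
  unfolding sum_distrib_left exp_add[symmetric]
  by (rule sum_mono) (use assms in \<open>simp add: add_divide_distrib[symmetric] divide_right_mono add.commute\<close>)

lemma log_sum_exp_nonexpansive:
  fixes q q' :: "'a::finite \<Rightarrow> real"
  assumes \<tau>: "0 < \<tau>" and close: "\<And>a. \<bar>q a - q' a\<bar> \<le> \<epsilon>"
  shows "\<bar>log_sum_exp \<tau> q - log_sum_exp \<tau> q'\<bar> \<le> \<epsilon>"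
proof -
  have le: "log_sum_exp \<tau> p \<le> log_sum_exp \<tau> p' + \<epsilon>" if "\<And>a. p a \<le> p' a + \<epsilon>" for p p' :: "'a \<Rightarrow> real"
  proof -
    have "ln (\<Sum>a\<in>UNIV. exp (p a / \<tau>)) \<le> ln (exp (\<epsilon> / \<tau>) * (\<Sum>a\<in>UNIV. exp (p' a / \<tau>)))"
      using sum_exp_shift_le[OF \<tau> that] sum_exp_pos[of p \<tau>] sum_exp_pos[of p' \<tau>]
      by (intro ln_mono) auto
    also have "\<dots> = \<epsilon> / \<tau> + ln (\<Sum>a\<in>UNIV. exp (p' a / \<tau>))"
      using sum_exp_pos[of p' \<tau>] by (simp add: ln_mult)
    finally have "log_sum_exp \<tau> p \<le> \<tau> * (\<epsilon> / \<tau> + ln (\<Sum>a\<in>UNIV. exp (p' a / \<tau>)))"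
      using \<tau> by (simp add: log_sum_exp_def)
    then show ?thesis
      using \<tau> by (simp add: log_sum_exp_def distrib_left)
  qed
  have "q a \<le> q' a + \<epsilon>" "q' a \<le> q a + \<epsilon>" for a
    using close[of a] by auto
  then show ?thesis
    using le[of q q'] le[of q' q] by (simp add: abs_le_iff)
qed

text \<open>Perturbing the logits by at most \<open>\<epsilon>\<close> changes the numerator and the normalizer each by a factor
  of at most \<open>exp (\<epsilon> / \<tau>)\<close>. Hence one probability is at least \<open>exp (- 2 \<epsilon> / \<tau>)\<close> times the other,
  and since probabilities are at most \<open>1\<close> the difference is at most \<open>1 - exp (- 2 \<epsilon> / \<tau>)\<close>.\<close>

lemma softmax_lipschitz:
  fixes q q' :: "'a::finite \<Rightarrow> real"
  assumes \<tau>: "0 < \<tau>" and close: "\<And>a. \<bar>q a - q' a\<bar> \<le> \<epsilon>"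
  shows "\<bar>pmf (softmax \<tau> q) a - pmf (softmax \<tau> q') a\<bar> \<le> 2 * \<epsilon> / \<tau>"
proof -
  have le: "pmf (softmax \<tau> p) a - pmf (softmax \<tau> p') a \<le> 2 * \<epsilon> / \<tau>"
    if c: "\<And>a. \<bar>p a - p' a\<bar> \<le> \<epsilon>" for p p' :: "'a \<Rightarrow> real"
  proof -
    let ?w = "pmf (softmax \<tau> p) a" and ?w' = "pmf (softmax \<tau> p') a"
    let ?Z = "\<Sum>a\<in>UNIV. exp (p a / \<tau>)" and ?Z' = "\<Sum>a\<in>UNIV. exp (p' a / \<tau>)"
    have "0 \<le> \<epsilon>"
      using c[of a] by linarith
    have "p' b \<le> p b + \<epsilon>" for b
      using c[of b] by auto
    then have Z: "?Z' \<le> exp (\<epsilon> / \<tau>) * ?Z"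
      by (rule sum_exp_shift_le[OF \<tau>])
    have "exp (- 2 * \<epsilon> / \<tau>) * ?w = exp ((p a - \<epsilon>) / \<tau>) / (exp (\<epsilon> / \<tau>) * ?Z)"
      by (simp add: pmf_softmax exp_diff exp_minus diff_divide_distrib field_simps
          flip: exp_add)
    also have "\<dots> \<le> exp (p' a / \<tau>) / ?Z'"
      using Z sum_exp_pos[of p' \<tau>] c[of a] \<tau>
      by (intro frac_le) (auto simp: divide_right_mono)
    also have "\<dots> = ?w'"
      by (simp add: pmf_softmax)
    finally have "?w - ?w' \<le> ?w * (1 - exp (- 2 * \<epsilon> / \<tau>))"
      by (simp add: algebra_simps)
    also have "\<dots> \<le> 1 * (1 - exp (- 2 * \<epsilon> / \<tau>))"
      using \<open>0 \<le> \<epsilon>\<close> \<tau> by (intro mult_right_mono pmf_le_1) auto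
    also have "\<dots> \<le> 2 * \<epsilon> / \<tau>"
      using exp_ge_add_one_self[of "- 2 * \<epsilon> / \<tau>"] by simp
    finally show ?thesis .
  qed
  from le[of q q'] le[of q' q] close show ?thesis
    by (simp add: abs_minus_commute abs_le_iff)
qed

section \<open>The soft Bellman equation\<close>

lemma bellman_defect_le:
  fixes r :: "'s::finite \<Rightarrow> 'a::finite \<Rightarrow> real"
  assumes "0 < \<tau>"
  shows "bellman_defect r P \<gamma> \<tau> \<pi> V s \<le> log_sum_exp \<tau> (q_backup r P \<gamma> V s) - V s"
  using gibbs_inequality[OF assms, of "\<pi> s" "q_backup r P \<gamma> V s"]
  by (simp add: bellman_defect_def entropy_at_def)

lemma bellman_defect_softmax:
  fixes r :: "'s::finite \<Rightarrow> 'a::finite \<Rightarrow> real"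
  assumes "0 < \<tau>"
  shows "bellman_defect r P \<gamma> \<tau> (\<lambda>s. softmax \<tau> (q_backup r P \<gamma> V s)) V s =
    log_sum_exp \<tau> (q_backup r P \<gamma> V s) - V s"
  using gibbs_equality[OF assms, of "q_backup r P \<gamma> V s"]
  by (simp add: bellman_defect_def entropy_at_def)

lemma q_backup_mono:
  fixes V W :: "'s::finite \<Rightarrow> real"
  assumes "0 \<le> \<gamma>" "\<And>s. V s \<le> W s"
  shows "q_backup r P \<gamma> V s a \<le> q_backup r P \<gamma> W s a"
  using assms by (auto simp: q_backup_def intro!: mult_left_mono expectation_mono_finite_type)

text \<open>By the Gibbs inequality no policy has a positive defect against a solution \<open>V\<close> of the soft
  Bellman equation, so \<open>V\<close> is an upper bound for all policy values; the softmax policy has zero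
  defect at every state, so one policy attains the bound for all initial states simultaneously.
  This is why the supremum can be moved inside the backup.\<close>

lemma opt_q_eq_q_backup:
  fixes r :: "'s::finite \<Rightarrow> 'a::finite \<Rightarrow> real"
  assumes \<gamma>: "0 \<le> \<gamma>" "\<gamma> < 1" and \<tau>: "0 < \<tau>"
    and fixpoint: "\<And>s. log_sum_exp \<tau> (q_backup r P \<gamma> V s) = V s"
  shows "opt_q r P \<gamma> \<tau> = q_backup r P \<gamma> V"
proof (intro ext)
  fix s a
  let ?\<pi> = "\<lambda>s. softmax \<tau> (q_backup r P \<gamma> V s)"
  have upper: "state_value r P \<gamma> \<tau> \<pi> s \<le> V s" for \<pi> s
  proof -
    have "measure_pmf.expectation p (bellman_defect r P \<gamma> \<tau> \<pi> V) \<le> 0" for p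
      using expectation_mono_finite_type[of "bellman_defect r P \<gamma> \<tau> \<pi> V" "\<lambda>_. 0" p]
        bellman_defect_le[OF \<tau>, of r P \<gamma> \<pi> V] fixpoint by simp
    then have "(\<Sum>t. \<gamma> ^ t * measure_pmf.expectation (visit_law P (return_pmf s) \<pi> t)
        (bellman_defect r P \<gamma> \<tau> \<pi> V)) \<le> (\<Sum>t. 0)"
      using \<gamma> by (intro suminf_le objective_eq_defect_sum(2)) (auto intro: mult_nonneg_nonpos)
    then show ?thesis
      unfolding state_value_def
      by (subst objective_eq_defect_sum(1)[OF \<gamma>, where V = V]) simp
  qed
  have "bellman_defect r P \<gamma> \<tau> ?\<pi> V = (\<lambda>_. 0)"
    using bellman_defect_softmax[OF \<tau>, of r P \<gamma> V] fixpoint by auto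
  then have attained: "state_value r P \<gamma> \<tau> ?\<pi> = V"
    unfolding state_value_def
    by (intro ext, subst objective_eq_defect_sum(1)[OF \<gamma>, where V = V]) simp
  show "opt_q r P \<gamma> \<tau> s a = q_backup r P \<gamma> V s a"
    unfolding opt_q_def
  proof (rule cSup_eq_maximum)
    show "q_backup r P \<gamma> V s a \<in> range (\<lambda>\<pi>. q_value r P \<gamma> \<tau> \<pi> s a)"
      by (rule range_eqI[where x = ?\<pi>]) (simp add: q_value_def attained)
  qed (auto simp: q_value_def intro!: q_backup_mono \<gamma> upper)
qed

section \<open>Geometric convergence of soft value iteration\<close>

lemma svi_value_Suc:
  "svi_value r P \<gamma> \<tau> (Suc n) s = log_sum_exp \<tau> (q_backup r P \<gamma> (svi_value r P \<gamma> \<tau> n) s)"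
  by (simp add: log_sum_exp_def)

declare svi_value.simps(2) [simp del]

lemma q_backup_contraction:
  fixes V W :: "'s::finite \<Rightarrow> real"
  assumes "0 \<le> \<gamma>" "\<And>s. \<bar>V s - W s\<bar> \<le> \<epsilon>"
  shows "\<bar>q_backup r P \<gamma> V s a - q_backup r P \<gamma> W s a\<bar> \<le> \<gamma> * \<epsilon>"
proof -
  have "q_backup r P \<gamma> V s a - q_backup r P \<gamma> W s a =
      \<gamma> * measure_pmf.expectation (P s a) (\<lambda>s. V s - W s)"
    by (simp add: q_backup_def integrable_measure_pmf_finite_type right_diff_distrib)
  then show ?thesis
    using assms abs_expectation_le[of "\<lambda>s. V s - W s" \<epsilon> "P s a"]
    by (simp add: abs_mult mult_left_mono)
qed

lemma soft_bellman_contraction: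
  fixes V W :: "'s::finite \<Rightarrow> real"
  assumes "0 \<le> \<gamma>" "0 < \<tau>" "\<And>s. \<bar>V s - W s\<bar> \<le> \<epsilon>"
  shows "\<bar>log_sum_exp \<tau> (q_backup r P \<gamma> V s) - log_sum_exp \<tau> (q_backup r P \<gamma> W s)\<bar> \<le> \<gamma> * \<epsilon>"
  using assms by (intro log_sum_exp_nonexpansive q_backup_contraction)

text \<open>The constant \<open>C\<close> solves \<open>R + \<tau> ln |A| + \<gamma> C = C\<close>: it is the value of receiving the largest
  reward and the largest entropy in every step.\<close>

context
  fixes r :: "'s::finite \<Rightarrow> 'a::finite \<Rightarrow> real" and P :: "'s \<Rightarrow> 'a \<Rightarrow> 's pmf"
    and \<gamma> \<tau> R C :: real
  assumes reward: "\<And>s a. \<bar>r s a\<bar> \<le> R"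
    and \<gamma>: "0 \<le> \<gamma>" "\<gamma> < 1" and \<tau>: "0 < \<tau>"
  defines "C \<equiv> (R + \<tau> * ln (real CARD('a))) / (1 - \<gamma>)"
begin

text \<open>The logits of a step are bounded by \<open>R + \<gamma> C\<close>, and log-sum-exp of the zero logits is
  \<open>\<tau> ln |A|\<close>; nonexpansiveness compares the two.\<close>

lemma abs_svi_value_le: "\<bar>svi_value r P \<gamma> \<tau> n s\<bar> \<le> C"
proof (induction n arbitrary: s)
  case 0
  have "0 \<le> R"
    using reward[of undefined undefined] by linarith
  moreover have "0 \<le> ln (real CARD('a))"
    by (intro ln_ge_zero) (simp add: Suc_le_eq)
  ultimately show ?case
    using \<gamma> \<tau> by (simp add: C_def)
next
  case (Suc n)
  let ?q = "q_backup r P \<gamma> (svi_value r P \<gamma> \<tau> n) s"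
  have "\<bar>?q a - 0\<bar> \<le> R + \<gamma> * C" for a
  proof -
    have "\<bar>\<gamma> * measure_pmf.expectation (P s a) (svi_value r P \<gamma> \<tau> n)\<bar> \<le> \<gamma> * C"
      using \<gamma> abs_expectation_le[OF Suc.IH, of "P s a"] by (simp add: abs_mult mult_left_mono)
    then show ?thesis
      using reward[of s a] by (simp add: q_backup_def)
  qed
  then have "\<bar>log_sum_exp \<tau> ?q - log_sum_exp \<tau> (\<lambda>_::'a. 0)\<bar> \<le> R + \<gamma> * C"
    by (rule log_sum_exp_nonexpansive[OF \<tau>])
  moreover have "log_sum_exp \<tau> (\<lambda>_::'a. 0) = \<tau> * ln (real CARD('a))"
    by (simp add: log_sum_exp_def)
  moreover have "0 \<le> \<tau> * ln (real CARD('a))"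
    using \<tau> by (intro mult_nonneg_nonneg ln_ge_zero) (auto simp: Suc_le_eq)
  moreover have "R + \<tau> * ln (real CARD('a)) + \<gamma> * C = C"
    using \<gamma> by (simp add: C_def field_simps)
  ultimately show ?case
    by (simp add: svi_value_Suc)
qed

text \<open>The first \<open>n\<close> steps of the iteration from \<open>0\<close> and the \<open>n\<close> steps that follow the \<open>m\<close>-th iterate
  apply the same contraction, to starting points at distance at most \<open>C\<close>.\<close>

lemma svi_value_cauchy_bound:
  "\<bar>svi_value r P \<gamma> \<tau> (n + m) s - svi_value r P \<gamma> \<tau> n s\<bar> \<le> \<gamma> ^ n * C"
proof (induction n arbitrary: s)
  case 0
  then show ?case
    using abs_svi_value_le by simp
next
  case (Suc n)
  show ?case
    unfolding add_Suc svi_value_Suc power_Suc mult.assoc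
    by (intro soft_bellman_contraction \<gamma> \<tau> Suc.IH)
qed

text \<open>The fixed point is the pointwise limit of the iterates. Letting \<open>m\<close> tend to infinity in the
  preceding bound gives the rate, and the rate makes the limit commute with the soft Bellman
  operator.\<close>

lemma svi_value_geometric_convergence:
  obtains V where "\<And>s. log_sum_exp \<tau> (q_backup r P \<gamma> V s) = V s"
    and "\<And>n s. \<bar>V s - svi_value r P \<gamma> \<tau> n s\<bar> \<le> \<gamma> ^ n * C"
proof -
  let ?v = "\<lambda>n s. svi_value r P \<gamma> \<tau> n s"
  have rate: "(\<lambda>n. \<gamma> ^ n * C) \<longlonglongrightarrow> 0"
    using \<gamma> by (intro tendsto_mult_left_zero LIMSEQ_power_zero) auto
  have "\<exists>l. (\<lambda>n. ?v n s) \<longlonglongrightarrow> l" for s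
  proof -
    have "Cauchy (\<lambda>n. ?v n s)"
      unfolding Cauchy_altdef2
    proof (intro allI impI)
      fix e :: real
      assume "0 < e"
      with rate have "\<forall>\<^sub>F n in sequentially. \<gamma> ^ n * C < e"
        by (rule order_tendstoD)
      then obtain N where N: "\<gamma> ^ N * C < e"
        by (auto simp: eventually_sequentially)
      have "dist (?v n s) (?v N s) < e" if "n \<ge> N" for n
        using svi_value_cauchy_bound[of N "n - N" s] N that by (simp add: dist_real_def)
      then show "\<exists>N. \<forall>n\<ge>N. dist (?v n s) (?v N s) < e"
        by blast
    qed
    then show ?thesis
      using Cauchy_convergent_iff by (auto simp: convergent_def)
  qed
  then obtain V where V: "\<And>s. (\<lambda>n. ?v n s) \<longlonglongrightarrow> V s"
    by metis
  have close: "\<bar>V s - ?v n s\<bar> \<le> \<gamma> ^ n * C" for n s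
  proof (rule tendsto_upperbound)
    show "(\<lambda>m. \<bar>?v (n + m) s - ?v n s\<bar>) \<longlonglongrightarrow> \<bar>V s - ?v n s\<bar>"
      using LIMSEQ_ignore_initial_segment[OF V, of n s]
      by (intro tendsto_intros) (simp add: add.commute)
  qed (auto simp: svi_value_cauchy_bound)
  have "log_sum_exp \<tau> (q_backup r P \<gamma> V s) = V s" for s
  proof -
    have "(\<lambda>n. ?v (Suc n) s) \<longlonglongrightarrow> log_sum_exp \<tau> (q_backup r P \<gamma> V s)"
    proof (rule LIM_zero_cancel, rule Lim_null_comparison)
      show "\<forall>\<^sub>F n in sequentially.
          norm (?v (Suc n) s - log_sum_exp \<tau> (q_backup r P \<gamma> V s)) \<le> \<gamma> * (\<gamma> ^ n * C)"
        unfolding svi_value_Suc real_norm_def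
        by (intro always_eventually allI soft_bellman_contraction \<gamma> \<tau>)
          (subst abs_minus_commute, rule close)
      show "(\<lambda>n. \<gamma> * (\<gamma> ^ n * C)) \<longlonglongrightarrow> 0"
        by (rule tendsto_mult_right_zero[OF rate])
    qed
    then show ?thesis
      using LIMSEQ_unique LIMSEQ_Suc[OF V] by blast
  qed
  with close show ?thesis
    using that by blast
qed

lemma policy_dist_svi_policy_le:
  assumes opt: "\<And>s. \<pi> s = softmax \<tau> (opt_q r P \<gamma> \<tau> s)" and n: "1 \<le> n"
  shows "policy_dist \<pi> (svi_policy r P \<gamma> \<tau> n) \<le> 2 * C / \<tau> * \<gamma> ^ n"
proof -
  obtain V where fixpoint: "\<And>s. log_sum_exp \<tau> (q_backup r P \<gamma> V s) = V s"
    and close: "\<And>n s. \<bar>V s - svi_value r P \<gamma> \<tau> n s\<bar> \<le> \<gamma> ^ n * C"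
    by (rule svi_value_geometric_convergence) auto
  have "\<bar>pmf (\<pi> s) a - pmf (svi_policy r P \<gamma> \<tau> n s) a\<bar> \<le> 2 * C / \<tau> * \<gamma> ^ n" for s a
  proof -
    \<comment> \<open>The policy uses the value function of \<open>n - 1\<close> iterations; its last backup contributes the
      missing factor \<open>\<gamma>\<close>.\<close>
    have "\<gamma> * (\<gamma> ^ (n - 1) * C) = \<gamma> ^ n * C"
      using n by (cases n) auto
    then have "\<bar>q_backup r P \<gamma> V s b - q_backup r P \<gamma> (svi_value r P \<gamma> \<tau> (n - 1)) s b\<bar> \<le> \<gamma> ^ n * C" for b
      using q_backup_contraction[OF \<gamma>(1), of V "svi_value r P \<gamma> \<tau> (n - 1)", OF close, of r P s b]
      by metis
    from softmax_lipschitz[of \<tau> "q_backup r P \<gamma> V s", OF \<tau> this, of a] show ?thesis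
      by (simp add: opt opt_q_eq_q_backup[OF \<gamma> \<tau> fixpoint] svi_policy_def mult_ac)
  qed
  then show ?thesis
    unfolding policy_dist_def by (subst Max_le_iff) auto
qed

end

section \<open>The number of iterations\<close>

text \<open>Solving \<open>B \<gamma>\<^sup>n \<le> \<delta>\<close> for \<open>n\<close> gives \<open>n \<ge> ln (B / \<delta>) / ln (1 / \<gamma>)\<close>. The maximum with
  \<open>1\<close> covers large \<open>\<delta>\<close>, for which this bound is zero or negative.\<close>

lemma geometric_threshold:
  fixes B \<gamma> :: real
  assumes B: "0 < B" and \<gamma>: "0 < \<gamma>" "\<gamma> < 1"
  obtains T :: "real \<Rightarrow> nat"
  where "(\<lambda>\<delta>. real (T \<delta>)) \<in> O[at_right 0](\<lambda>\<delta>. ln (1 / \<delta>))"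
    and "\<And>\<delta>. 1 \<le> T \<delta>"
    and "\<And>\<delta> n. 0 < \<delta> \<Longrightarrow> T \<delta> \<le> n \<Longrightarrow> B * \<gamma> ^ n \<le> \<delta>"
proof
  define L where "L = ln (1 / \<gamma>)"
  have L: "0 < L"
    using \<gamma> by (simp add: L_def)
  define T where "T \<delta> = max 1 (nat \<lceil>ln (B / \<delta>) / L\<rceil>)" for \<delta>
  show "1 \<le> T \<delta>" for \<delta>
    by (simp add: T_def)
  show "B * \<gamma> ^ n \<le> \<delta>" if \<delta>: "0 < \<delta>" and n: "T \<delta> \<le> n" for \<delta> n
  proof -
    have "ln (B / \<delta>) / L \<le> real n"
      using n unfolding T_def by linarith
    then have "ln B - ln \<delta> \<le> real n * L"
      using L B \<delta> by (simp add: ln_div field_simps)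
    then have "ln (B * \<gamma> ^ n) \<le> ln \<delta>"
      using B \<gamma> by (simp add: L_def ln_mult ln_div ln_realpow)
    then show ?thesis
      using B \<gamma> \<delta> by simp
  qed
  show "(\<lambda>\<delta>. real (T \<delta>)) \<in> O[at_right 0](\<lambda>\<delta>. ln (1 / \<delta>))"
  proof (rule bigoI)
    \<comment> \<open>Below \<open>exp (-1)\<close> one has \<open>ln (1 / \<delta>) \<ge> 1\<close>, which absorbs the additive constants.\<close>
    have "\<forall>\<^sub>F \<delta> in at_right 0. \<delta> \<in> {0<..<exp (- 1 :: real)}"
      by (rule eventually_at_right_real) simp
    then show "\<forall>\<^sub>F \<delta> in at_right 0.
        norm (real (T \<delta>)) \<le> (1 + (\<bar>ln B\<bar> + 1) / L) * norm (ln (1 / \<delta>))"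
    proof eventually_elim
      case (elim \<delta>)
      then have \<delta>: "0 < \<delta>" "\<delta> < exp (- 1)"
        by auto
      define l where "l = ln (1 / \<delta>)"
      have "ln \<delta> \<le> ln (exp (- 1))"
        using \<delta> by (subst ln_le_cancel_iff) auto
      then have l: "1 \<le> l"
        using \<delta> by (simp add: l_def ln_div)
      have "ln (B / \<delta>) = ln B + l"
        using B \<delta> by (simp add: l_def ln_div)
      then have "\<bar>ln (B / \<delta>)\<bar> \<le> \<bar>ln B\<bar> + l"
        using l by linarith
      also have "\<dots> \<le> \<bar>ln B\<bar> * l + l"
        using l mult_left_mono[of 1 l "\<bar>ln B\<bar>"] by simp
      finally have "\<bar>ln (B / \<delta>) / L\<bar> \<le> (\<bar>ln B\<bar> + 1) / L * l"
        using L by (simp add: field_simps)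
      moreover have "real (T \<delta>) \<le> 1 + \<bar>ln (B / \<delta>) / L\<bar>"
        unfolding T_def by linarith
      ultimately have "real (T \<delta>) \<le> (1 + (\<bar>ln B\<bar> + 1) / L) * l"
        using l by (simp add: distrib_right)
      then show ?case
        using l by (simp add: l_def[symmetric])
    qed
  qed
qed

theorem proposition5:
  fixes r :: "'x \<Rightarrow> 'xi \<Rightarrow> 's::finite \<Rightarrow> 'a::finite \<Rightarrow> real"
    and P :: "'x \<Rightarrow> 'xi \<Rightarrow> 's \<Rightarrow> 'a \<Rightarrow> 's pmf"
    and \<mu> :: "'x \<Rightarrow> 'xi \<Rightarrow> 's pmf"
    and R \<gamma> \<tau> :: real
    and \<pi>_opt :: "'x \<Rightarrow> 'xi \<Rightarrow> 's \<Rightarrow> 'a pmf"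
  assumes reward_bound: "\<And>x \<xi> s a. \<bar>r x \<xi> s a\<bar> < R"
    and discount: "0 < \<gamma>" "\<gamma> < 1"
    and reg: "0 < \<tau>"
    and opt: "\<And>x \<xi>. optimal_policy (r x \<xi>) (P x \<xi>) \<gamma> \<tau> (\<mu> x \<xi>) (\<pi>_opt x \<xi>)"
  shows "\<exists>T :: real \<Rightarrow> nat.
      (\<lambda>\<delta>. real (T \<delta>)) \<in> O[at_right 0](\<lambda>\<delta>. ln (1 / \<delta>)) \<and>
      (\<forall>\<delta>>0. 1 \<le> T \<delta> \<and>
        (\<forall>n\<ge>T \<delta>. \<forall>x \<xi>.
          (policy_dist (\<pi>_opt x \<xi>) (svi_policy (r x \<xi>) (P x \<xi>) \<gamma> \<tau> n))\<^sup>2 \<le> \<delta>\<^sup>2))"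
proof -
  define B where "B = 2 * ((R + \<tau> * ln (real CARD('a))) / (1 - \<gamma>)) / \<tau>"
  have "0 < R"
    using reward_bound[of undefined undefined undefined undefined] by linarith
  moreover have "0 \<le> \<tau> * ln (real CARD('a))"
    using reg by (intro mult_nonneg_nonneg ln_ge_zero) (auto simp: Suc_le_eq)
  ultimately have "0 < B"
    using discount reg unfolding B_def by (intro divide_pos_pos mult_pos_pos add_pos_nonneg) auto
  then obtain T :: "real \<Rightarrow> nat"
    where growth: "(\<lambda>\<delta>. real (T \<delta>)) \<in> O[at_right 0](\<lambda>\<delta>. ln (1 / \<delta>))"
      and T1: "\<And>\<delta>. 1 \<le> T \<delta>"
      and T: "\<And>\<delta> n. 0 < \<delta> \<Longrightarrow> T \<delta> \<le> n \<Longrightarrow> B * \<gamma> ^ n \<le> \<delta>"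
    by (rule geometric_threshold[OF _ discount]) auto
  have "(policy_dist (\<pi>_opt x \<xi>) (svi_policy (r x \<xi>) (P x \<xi>) \<gamma> \<tau> n))\<^sup>2 \<le> \<delta>\<^sup>2"
    if "0 < \<delta>" "T \<delta> \<le> n" for \<delta> n x \<xi>
  proof (rule power_mono)
    have "\<pi>_opt x \<xi> s = softmax \<tau> (opt_q (r x \<xi>) (P x \<xi>) \<gamma> \<tau> s)" for s
      using opt[of x \<xi>] by (simp add: optimal_policy_def)
    then have "policy_dist (\<pi>_opt x \<xi>) (svi_policy (r x \<xi>) (P x \<xi>) \<gamma> \<tau> n) \<le> B * \<gamma> ^ n"
      unfolding B_def using reward_bound discount reg T1[of \<delta>] that
      by (intro policy_dist_svi_policy_le) (auto intro: less_imp_le)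
    also have "\<dots> \<le> \<delta>"
      using T that by blast
    finally show "policy_dist (\<pi>_opt x \<xi>) (svi_policy (r x \<xi>) (P x \<xi>) \<gamma> \<tau> n) \<le> \<delta>" .
    show "0 \<le> policy_dist (\<pi>_opt x \<xi>) (svi_policy (r x \<xi>) (P x \<xi>) \<gamma> \<tau> n)"
      unfolding policy_dist_def by (subst Max_ge_iff) auto
  qed
  with growth T1 show ?thesis
    by blast
qed

end
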